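(* Let $\epsilon>0$ be a constant. Any deterministic clock auction that is augmented with a prediction $\hat{\texttt{OPT}}$ and is $(1+\epsilon)$-consistent has robustness $\Omega\!\left(\frac{1}{\epsilon}\log n\right)$, where $n$ is the number of bidders.
   Context: Setting: a set $N$ of $n$ bidders with private values $v_i\ge v_{\min}>0$; a public downward-closed family $\mathcal F\subseteq 2^N$ of feasible sets; $v(S)=\sum_{i\in S}v_i$; $\texttt{OPT}(I)$ is a maximum-value feasible set of instance $I$. A clock auction offers each active bidder personalized prices that are non-decreasing over time and depend only on public information (feasibility system, prediction, price history, exit history); a bidder stays while the price is at most her value and otherwise permanently exits; the auction ends when the active set is feasible and serves it. A learning-augmented auction $\mathcal M$ additionally receives a prediction $\hat{\texttt{OPT}}\in\mathcal F$ (possibly wrong). Robustness: $\max_{I,\hat{\texttt{OPT}}}v(\texttt{OPT}(I))/v(\mathcal M(I,\hat{\texttt{OPT}}))$. Consistency: $\max_I v(\texttt{OPT}(I))/v(\mathcal M(I,\texttt{OPT}(I)))$. $c$-consistent means consistency at most $c$. *)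

theory Defs
  imports "HOL-Library.Extended_Real"
begin

definition feasibility_system :: "nat \<Rightarrow> nat set set \<Rightarrow> bool" where
  "feasibility_system n F \<longleftrightarrow>
     F \<subseteq> Pow {..<n} \<and> {} \<in> F \<and> (\<forall>S\<in>F. \<forall>T. T \<subseteq> S \<longrightarrow> T \<in> F)"

definition setval :: "(nat \<Rightarrow> real) \<Rightarrow> nat set \<Rightarrow> real" where
  "setval v S = (\<Sum>i\<in>S. v i)"

definition opt_val :: "nat set set \<Rightarrow> (nat \<Rightarrow> real) \<Rightarrow> real" where
  "opt_val F v = Max (setval v ` F)"

definition is_opt :: "nat set set \<Rightarrow> (nat \<Rightarrow> real) \<Rightarrow> nat set \<Rightarrow> bool" where
  "is_opt F v S \<longleftrightarrow> S \<in> F \<and> setval v S = opt_val F v"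

text \<open>A deterministic (learning-augmented) clock auction, modelled in discrete rounds.
The price vector offered in a round is a function of the public information only:
the feasibility system, the prediction, and the history of active sets (the exit
history; the price history is itself determined by these data since the auction
is deterministic).\<close>

type_synonym auction = "nat set set \<Rightarrow> nat set \<Rightarrow> nat set list \<Rightarrow> nat \<Rightarrow> real"

fun hist :: "auction \<Rightarrow> nat \<Rightarrow> nat set set \<Rightarrow> nat set \<Rightarrow> (nat \<Rightarrow> real) \<Rightarrow> nat \<Rightarrow> nat set list" where
  "hist M n F P v 0 = [{..<n}]"
| "hist M n F P v (Suc t) =
     (let h = hist M n F P v t; A = last h; p = M F P h in h @ [{i\<in>A. p i \<le> v i}])"

definition active :: "auction \<Rightarrow> nat \<Rightarrow> nat set set \<Rightarrow> nat set \<Rightarrow> (nat \<Rightarrow> real) \<Rightarrow> nat \<Rightarrow> nat set" where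
  "active M n F P v t = last (hist M n F P v t)"

definition price :: "auction \<Rightarrow> nat \<Rightarrow> nat set set \<Rightarrow> nat set \<Rightarrow> (nat \<Rightarrow> real) \<Rightarrow> nat \<Rightarrow> nat \<Rightarrow> real" where
  "price M n F P v t = M F P (hist M n F P v t)"

definition outcome :: "auction \<Rightarrow> nat \<Rightarrow> nat set set \<Rightarrow> nat set \<Rightarrow> (nat \<Rightarrow> real) \<Rightarrow> nat set" where
  "outcome M n F P v =
     (if \<exists>t. active M n F P v t \<in> F
      then active M n F P v (LEAST t. active M n F P v t \<in> F) else {})"

definition valid_instance :: "nat \<Rightarrow> real \<Rightarrow> nat set set \<Rightarrow> (nat \<Rightarrow> real) \<Rightarrow> bool" where
  "valid_instance n vmin F v \<longleftrightarrow> feasibility_system n F \<and> (\<forall>i<n. vmin \<le> v i)"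

definition clock_auction :: "nat \<Rightarrow> real \<Rightarrow> auction \<Rightarrow> bool" where
  "clock_auction n vmin M \<longleftrightarrow>
     (\<forall>F P v t. valid_instance n vmin F v \<and> P \<in> F \<longrightarrow>
        active M n F P v (Suc t) \<notin> F \<longrightarrow>
        (\<forall>i\<in>active M n F P v (Suc t). price M n F P v t i \<le> price M n F P v (Suc t) i))"

definition ratio :: "real \<Rightarrow> real \<Rightarrow> ereal" where
  "ratio a b = (if b = 0 then (if a = 0 then 1 else \<infinity>) else ereal (a / b))"

definition inst_ratio :: "auction \<Rightarrow> nat \<Rightarrow> nat set set \<Rightarrow> nat set \<Rightarrow> (nat \<Rightarrow> real) \<Rightarrow> ereal" where
  "inst_ratio M n F P v = ratio (opt_val F v) (setval v (outcome M n F P v))"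

definition robustness :: "nat \<Rightarrow> real \<Rightarrow> auction \<Rightarrow> ereal" where
  "robustness n vmin M =
     (SUP (F, P, v) \<in> {(F, P, v). valid_instance n vmin F v \<and> P \<in> F}. inst_ratio M n F P v)"

definition consistency :: "nat \<Rightarrow> real \<Rightarrow> auction \<Rightarrow> ereal" where
  "consistency n vmin M =
     (SUP (F, P, v) \<in> {(F, P, v). valid_instance n vmin F v \<and> is_opt F v P}. inst_ratio M n F P v)"

end

theory Submission
  imports Defs "HOL-Analysis.Harmonic_Numbers"
begin

text \<open>
  The predicted set \<open>A\<close> has \<open>m = n - 1\<close> bidders and competes with a single bidder \<open>0\<close> of value
  \<open>K = m ln n / (2\<epsilon>)\<close> (in units of \<open>vmin\<close>); the feasible sets are \<open>{0}\<close> and the subsets of \<open>A\<close>.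
  An adversary fixes the values in \<open>A\<close> adaptively: while \<open>k\<close> of these bidders are left, each of them
  accepts prices up to \<open>m / k\<close>, so the survivors are worth \<open>m\<close> in total, and the first one
  asked for more leaves with value \<open>m / k\<close>. If the auction gets rid of bidder \<open>0\<close> while some
  survivors are left, then it serves a value of at most \<open>m\<close> whereas the optimum is at least \<open>K\<close>.
  Otherwise a single survivor is reached while bidder \<open>0\<close> is still active. At that point the
  bidders that left are worth \<open>m (H\<^sub>m - 1) > \<epsilon> K\<close>. Let the survivor have value \<open>K\<close>: whatever is
  served now is worth at most \<open>K\<close>, while the prediction \<open>A\<close> is optimal and worth more than
  \<open>(1 + \<epsilon>) K\<close>, contradicting consistency.
\<close>

section \<open>Runs of the auction under changed values\<close>

lemma active_0: "active M n F P v 0 = {..<n}"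
  by (simp add: active_def)

lemma active_Suc:
  "active M n F P v (Suc t) = {i \<in> active M n F P v t. price M n F P v t i \<le> v i}"
  by (simp add: active_def price_def Let_def)

lemma active_antimono: "s \<le> t \<Longrightarrow> active M n F P v t \<subseteq> active M n F P v s"
  by (induction t rule: dec_induct) (auto simp: active_Suc)

text \<open>A bidder active at \<open>t\<close> has accepted every earlier price and would do so
  with a higher value. This lets the adversary revise survivors' values in hindsight.\<close>

lemma hist_cong_raise:
  assumes "\<And>i. w i = v i \<or> i \<in> active M n F P v t \<and> v i \<le> w i"
  shows "hist M n F P w t = hist M n F P v t"
  using assms
proof (induction t)
  case (Suc t)
  have "hist M n F P w t = hist M n F P v t"
    using Suc.prems by (intro Suc.IH) (auto simp: active_Suc)
  moreover have "price M n F P v t i \<le> w i \<longleftrightarrow> price M n F P v t i \<le> v i" for i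
    using Suc.prems[of i] by (auto simp: active_Suc)
  ultimately show ?case
    by (simp add: Let_def price_def)
qed simp

section \<open>The rival instance and its cornered states\<close>

definition rival_system :: "nat \<Rightarrow> nat set set" where
  "rival_system n = insert {0} (Pow {1..<n})"

lemma finite_rival_system: "finite (rival_system n)"
  by (simp add: rival_system_def)

lemma feasibility_rival_system: "0 < n \<Longrightarrow> feasibility_system n (rival_system n)"
  by (auto simp: feasibility_system_def rival_system_def)

lemma rival_system_cases: "S \<in> rival_system n \<Longrightarrow> S = {0} \<or> S \<subseteq> {1..<n}"
  by (auto simp: rival_system_def)

lemma opt_val_ge: "finite F \<Longrightarrow> S \<in> F \<Longrightarrow> setval v S \<le> opt_val F v"
  by (simp add: opt_val_def)

text \<open>
  The bidders outside \<open>insert 0 X\<close> have left while bidder \<open>0\<close> is still active at time \<open>t\<close>. The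
  bidders in \<open>X\<close> are only required to survive until \<open>s\<close>, because in the last round several of them
  may refuse at once, and these departures are processed one by one.
\<close>

definition cornered ::
  "auction \<Rightarrow> nat \<Rightarrow> nat set set \<Rightarrow> nat set \<Rightarrow> (nat \<Rightarrow> real) \<Rightarrow> nat set \<Rightarrow> nat \<Rightarrow> nat \<Rightarrow> bool" where
  "cornered M n F P v X s t \<longleftrightarrow> s \<le> t \<and> t \<le> Suc s \<and> X \<subseteq> active M n F P v s \<and>
     0 \<in> active M n F P v t \<and> active M n F P v t \<subseteq> insert 0 X"

text \<open>Histories agree only up to \<open>s\<close>. In a further round the answers of
  \<open>X\<close> may change, but the conditions at \<open>t\<close> do not depend on them.\<close>

lemma cornered_raise:
  assumes c: "cornered M n F P v X s t" and "0 \<notin> X"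
    and off: "\<And>i. i \<notin> X \<Longrightarrow> w i = v i" and on: "\<And>i. i \<in> X \<Longrightarrow> v i \<le> w i"
  shows "cornered M n F P w X s t"
proof -
  have h: "hist M n F P w s = hist M n F P v s"
    using c off on by (intro hist_cong_raise) (auto simp: cornered_def)
  have a: "active M n F P w s = active M n F P v s"
    and p: "price M n F P w s = price M n F P v s"
    by (simp_all add: h active_def price_def)
  consider "t = s" | "t = Suc s"
    using c by (auto simp: cornered_def le_Suc_eq)
  then show ?thesis
  proof cases
    case 1
    then show ?thesis using c a by (simp add: cornered_def)
  next
    case 2
    have "i \<in> active M n F P w t \<longleftrightarrow> i \<in> active M n F P v t" if "i \<notin> X" for i
      using off[OF that] by (simp add: 2 active_Suc a p)
    then show ?thesis
      using c a \<open>0 \<notin> X\<close> by (auto simp: cornered_def)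
  qed
qed

text \<open>Take the first time \<open>q\<close> at which \<open>X\<close> is incomplete: one
  missing bidder becomes \<open>x\<close>, and the others were all present one round earlier, which
  gives the new \<open>s'\<close>.\<close>

lemma cornered_departure:
  assumes c: "cornered M n F P v X s t"
    and "0 \<in> active M n F P v r" "\<not> X \<subseteq> active M n F P v r"
  obtains x s' t' where "x \<in> X" "cornered M n F P v (X - {x}) s' t'"
proof -
  let ?act = "active M n F P v"
  define q where "q = (LEAST q. \<not> X \<subseteq> ?act q)"
  have q: "\<not> X \<subseteq> ?act q"
    unfolding q_def using assms(3) by (rule LeastI)
  have "q \<le> r"
    unfolding q_def using assms(3) by (rule Least_le)
  have before: "X \<subseteq> ?act q'" if "q' < q" for q'
    using that not_less_Least unfolding q_def by blast
  have "s < q"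
    using q c active_antimono[of q s M n F P v] by (force simp: cornered_def not_less)
  then obtain s' where s': "q = Suc s'"
    by (cases q) auto
  have "?act q \<subseteq> ?act t"
    using c \<open>s < q\<close> by (intro active_antimono) (auto simp: cornered_def)
  moreover have "0 \<in> ?act q"
    using assms(2) active_antimono[OF \<open>q \<le> r\<close>] by blast
  moreover obtain x where "x \<in> X" "x \<notin> ?act q"
    using q by blast
  ultimately have "cornered M n F P v (X - {x}) s' q"
    using c s' before[of s'] by (auto simp: cornered_def)
  with \<open>x \<in> X\<close> show thesis
    by (rule that)
qed

lemma cornered_outcome:
  assumes c: "cornered M n F P v X s t" and F: "F = rival_system n"
    and X: "X \<noteq> {}" "0 \<notin> X"
  shows "outcome M n F P v \<subseteq> X \<or>
    outcome M n F P v = {0} \<and> (\<exists>r. active M n F P v r = {0})"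
proof (cases "\<exists>r. active M n F P v r \<in> F")
  case True
  let ?act = "active M n F P v"
  define q where "q = (LEAST r. ?act r \<in> F)"
  have q: "?act q \<in> F"
    unfolding q_def using True by (rule LeastI_ex)
  have out: "outcome M n F P v = ?act q"
    using True by (simp add: outcome_def q_def)
  show ?thesis
  proof (cases "0 \<in> ?act q")
    case True
    then have "?act q = {0}"
      using rival_system_cases[of "?act q" n] q F by auto
    then show ?thesis
      using out by auto
  next
    case False
    \<comment> \<open>Bidder \<open>0\<close> is still active at \<open>t\<close>, so an end without
      her cannot come earlier.\<close>
    then have "t \<le> q"
      using c active_antimono[of q t M n F P v] by (force simp: cornered_def)
    then have "?act q \<subseteq> insert 0 X"
      using c active_antimono[of t q M n F P v] by (auto simp: cornered_def)
    then show ?thesis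
      using False out by auto
  qed
qed (simp add: outcome_def)

section \<open>The adversary and the lower bound\<close>

lemma inst_ratio_ge:
  assumes "K \<le> opt_val F v" "0 < K" "0 < D"
    and "0 \<le> setval v (outcome M n F P v)" "setval v (outcome M n F P v) \<le> D"
  shows "ereal (K / D) \<le> inst_ratio M n F P v"
proof (cases "setval v (outcome M n F P v) = 0")
  case False
  then have "K / D \<le> opt_val F v / setval v (outcome M n F P v)"
    using assms by (intro frac_le) auto
  with False show ?thesis
    by (simp add: inst_ratio_def ratio_def)
qed (use assms in \<open>auto simp: inst_ratio_def ratio_def\<close>)

lemma inst_ratio_le_robustness:
  "valid_instance n vmin F v \<Longrightarrow> P \<in> F \<Longrightarrow> inst_ratio M n F P v \<le> robustness n vmin M"
  unfolding robustness_def by (rule SUP_upper2[of "(F, P, v)"]) auto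

lemma inst_ratio_le_consistency:
  "valid_instance n vmin F v \<Longrightarrow> is_opt F v P \<Longrightarrow> inst_ratio M n F P v \<le> consistency n vmin M"
  unfolding consistency_def by (rule SUP_upper2[of "(F, P, v)"]) auto

lemma harmonic_departures:
  fixes n :: nat and vmin K :: real and M :: auction
  defines "m \<equiv> n - 1" and "A \<equiv> {1..<n}" and "F \<equiv> rival_system n"
  defines "D \<equiv> real m * vmin"
  assumes vmin: "0 < vmin" and K: "D \<le> K" and k: "1 \<le> k" "k \<le> m"
    and rob: "robustness n vmin M < ereal (K / D)"
  shows "\<exists>X v s t. X \<subseteq> A \<and> card X = k \<and> v 0 = K \<and> (\<forall>i\<in>A. vmin \<le> v i) \<and>
    (\<forall>i\<in>X. v i = D / real k) \<and> setval v (A - X) = D * (harm m - harm k) \<and>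
    cornered M n F A v X s t"
  using k(2,1)
proof (induction k rule: inc_induct)
  case base
  let ?v = "\<lambda>i::nat. if i = 0 then K else vmin"
  \<comment> \<open>With \<open>k = m\<close> the common value \<open>D / m\<close> is
    \<open>vmin\<close>, and no price has been offered yet.\<close>
  have "cornered M n F A ?v A 0 0"
    using base by (auto simp: cornered_def active_0 A_def m_def)
  then show ?case
    using base by (intro exI[of _ A] exI[of _ ?v] exI[of _ 0])
      (auto simp: A_def m_def D_def setval_def)
next
  case (step k)
  let ?k = "Suc k"
  obtain X v s t where X: "X \<subseteq> A" "card X = ?k" and v0: "v 0 = K"
    and vA: "\<forall>i\<in>A. vmin \<le> v i" and vX: "\<forall>i\<in>X. v i = D / real ?k"
    and sum: "setval v (A - X) = D * (harm m - harm ?k)"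
    and c: "cornered M n F A v X s t"
    using step.IH by auto
  have fin: "finite A" "finite X" and "0 \<notin> X" "X \<noteq> {}"
    using X by (auto simp: A_def intro: finite_subset)
  have D: "0 < D"
    using step vmin by (simp add: D_def)
  have n: "0 < n"
    using step by (simp add: m_def)
  \<comment> \<open>Serving survivors only yields at most \<open>D\<close>, while bidder
    \<open>0\<close> alone is worth \<open>K\<close>.\<close>
  have "\<not> outcome M n F A v \<subseteq> X"
  proof
    assume out: "outcome M n F A v \<subseteq> X"
    have pos: "0 \<le> v i" if "i \<in> X" for i
      using vX D that by simp
    have "setval v (outcome M n F A v) \<le> setval v X"
      unfolding setval_def using fin out pos by (intro sum_mono2) auto
    also have "\<dots> = D"
      using vX X(2) by (simp add: setval_def)
    finally have "setval v (outcome M n F A v) \<le> D" .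
    moreover have "0 \<le> setval v (outcome M n F A v)"
      unfolding setval_def using out pos by (intro sum_nonneg) auto
    moreover have "K \<le> opt_val F v"
      using opt_val_ge[of F "{0}" v] v0
      by (simp add: F_def finite_rival_system setval_def rival_system_def)
    ultimately have "ereal (K / D) \<le> inst_ratio M n F A v"
      using D K by (intro inst_ratio_ge) auto
    also have "\<dots> \<le> robustness n vmin M"
    proof (rule inst_ratio_le_robustness)
      have "1 * vmin \<le> D"
        unfolding D_def using step.hyps vmin by (intro mult_right_mono) auto
      then have "vmin \<le> K"
        using K by simp
      then have "vmin \<le> v i" if "i < n" for i
        using vA v0 that by (cases "i = 0") (auto simp: A_def)
      then show "valid_instance n vmin F v"
        using n by (simp add: valid_instance_def F_def feasibility_rival_system)
      show "A \<in> F"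
        by (simp add: A_def F_def rival_system_def)
    qed
    finally show False
      using rob by simp
  qed
  then obtain r where r: "active M n F A v r = {0}"
    using cornered_outcome[OF c F_def[THEN meta_eq_to_obj_eq] \<open>X \<noteq> {}\<close> \<open>0 \<notin> X\<close>] by blast
  then have "0 \<in> active M n F A v r" "\<not> X \<subseteq> active M n F A v r"
    using \<open>0 \<notin> X\<close> \<open>X \<noteq> {}\<close> by auto
  with c obtain x s' t' where x: "x \<in> X" and c': "cornered M n F A v (X - {x}) s' t'"
    by (rule cornered_departure)
  \<comment> \<open>The departed \<open>x\<close> keeps \<open>D / Suc k\<close>, the next harmonic
    term; raising the other \<open>k\<close> bidders to \<open>D / k\<close> restores their total
    \<open>D\<close>.\<close>
  define Y w where "Y = X - {x}" and "w = (\<lambda>i. if i \<in> Y then D / real k else v i)"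
  have Y: "Y \<subseteq> A" "card Y = k" "0 \<notin> Y"
    using X x \<open>0 \<notin> X\<close> fin by (auto simp: Y_def)
  have "D / real ?k \<le> D / real k"
    using D step by (intro divide_left_mono) auto
  then have "cornered M n F A w Y s' t'"
    using vX by (intro cornered_raise[OF c'[folded Y_def] \<open>0 \<notin> Y\<close>]) (auto simp: w_def Y_def)
  moreover have "vmin \<le> D / real k"
    using step vmin by (simp add: D_def field_simps)
  moreover have "setval w (A - Y) = D * (harm m - harm k)"
  proof -
    have "A - Y = insert x (A - X)"
      using x X by (auto simp: Y_def)
    moreover have "setval w (A - Y) = setval v (A - Y)"
      unfolding setval_def by (intro sum.cong) (auto simp: w_def)
    ultimately have "setval w (A - Y) = setval v (insert x (A - X))"
      by simp
    also have "\<dots> = D / real ?k + setval v (A - X)"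
      using x vX fin by (simp add: setval_def)
    also have "\<dots> = D * (harm m - harm k)"
      unfolding sum harm_Suc by (simp add: divide_inverse right_diff_distrib distrib_left)
    finally show ?thesis .
  qed
  moreover have "w 0 = K"
    using v0 Y by (simp add: w_def)
  ultimately show ?case
    using Y vA by (intro exI[of _ Y] exI[of _ w] exI[of _ s'] exI[of _ t']) (auto simp: w_def)
qed

lemma robustness_lower_bound:
  fixes n :: nat and vmin \<epsilon> K :: real and M :: auction
  defines "m \<equiv> n - 1"
  defines "D \<equiv> real m * vmin"
  assumes vmin: "0 < vmin" and eps: "0 < \<epsilon>" and m: "1 \<le> m" and K: "D \<le> K"
    and harm: "\<epsilon> * K < D * (harm m - 1)"
    and cons: "consistency n vmin M \<le> ereal (1 + \<epsilon>)"
  shows "ereal (K / D) \<le> robustness n vmin M"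
proof (rule ccontr)
  let ?A = "{1..<n}" and ?F = "rival_system n"
  assume "\<not> ?thesis"
  then have "robustness n vmin M < ereal (K / D)"
    by simp
  from harmonic_departures[OF vmin K[unfolded D_def m_def] _ m[unfolded m_def]
      this[unfolded D_def m_def], folded m_def, folded D_def]
  obtain X v s t where X: "X \<subseteq> ?A" "card X = 1" and v0: "v 0 = K"
    and vA: "\<forall>i\<in>?A. vmin \<le> v i" and vX: "\<forall>i\<in>X. v i = D"
    and sum: "setval v (?A - X) = D * (harm m - 1)"
    and c: "cornered M n ?F ?A v X s t"
    by (auto simp: harm_expand)
  obtain x where x: "X = {x}"
    using X(2) by (auto simp: card_Suc_eq)
  have D: "0 < D" and "vmin \<le> D"
    using vmin m mult_right_mono[of 1 "real m" vmin] by (simp_all add: D_def)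
  \<comment> \<open>With the last survivor also worth \<open>K\<close>, no possible outcome exceeds
    \<open>K\<close>, whichever of the two rivals wins.\<close>
  define w where "w = v(x := K)"
  have "0 \<notin> X"
    using X by auto
  have "cornered M n ?F ?A w X s t"
    using vX K by (intro cornered_raise[OF c \<open>0 \<notin> X\<close>]) (auto simp: w_def x)
  then have "outcome M n ?F ?A w \<subseteq> {x} \<or> outcome M n ?F ?A w = {0}"
    using cornered_outcome[OF _ refl _ \<open>0 \<notin> X\<close>] x by blast
  then consider "outcome M n ?F ?A w = {}" | "outcome M n ?F ?A w = {x}"
    | "outcome M n ?F ?A w = {0}"
    by blast
  moreover have "w 0 = K" "w x = K"
    using v0 \<open>0 \<notin> X\<close> by (auto simp: w_def x)
  ultimately have "setval w (outcome M n ?F ?A w) \<in> {0, K}"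
    by cases (simp_all add: setval_def)
  then have served: "0 \<le> setval w (outcome M n ?F ?A w)"
      "setval w (outcome M n ?F ?A w) \<le> K"
    using D K by auto
  have wA: "vmin \<le> w i" if "i < n" for i
    using vA v0 that K \<open>vmin \<le> D\<close> by (cases "i = 0") (auto simp: w_def)
  have "setval w ?A = w x + setval w (?A - X)"
    using X by (simp add: setval_def x sum.remove)
  also have "setval w (?A - X) = setval v (?A - X)"
    unfolding setval_def by (intro sum.cong) (auto simp: w_def x)
  finally have wP: "(1 + \<epsilon>) * K < setval w ?A"
    using sum harm \<open>w x = K\<close> by (simp add: algebra_simps)
  have "K \<le> (1 + \<epsilon>) * K"
    using eps D K by simp
  then have KP: "K < setval w ?A"
    using wP by simp
  have "setval w S \<le> setval w ?A" if "S \<in> ?F" for S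
    using rival_system_cases[OF that]
  proof
    assume "S = {0}"
    then show ?thesis
      using KP \<open>w 0 = K\<close> by (simp add: setval_def)
  next
    assume "S \<subseteq> ?A"
    moreover have "0 \<le> w i" if "i \<in> ?A" for i
      using wA[of i] vmin that by simp
    ultimately show ?thesis
      unfolding setval_def by (intro sum_mono2) auto
  qed
  then have opt: "opt_val ?F w = setval w ?A"
    unfolding opt_val_def using finite_rival_system
    by (intro Max_eqI) (auto simp: rival_system_def)
  have "ereal (setval w ?A / K) \<le> inst_ratio M n ?F ?A w"
    using served opt KP D K by (intro inst_ratio_ge) auto
  also have "\<dots> \<le> consistency n vmin M"
  proof (rule inst_ratio_le_consistency)
    show "valid_instance n vmin ?F w"
      using wA m by (simp add: valid_instance_def feasibility_rival_system m_def)
    show "is_opt ?F w ?A"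
      using opt by (simp add: is_opt_def rival_system_def)
  qed
  also note cons
  finally have "setval w ?A \<le> (1 + \<epsilon>) * K"
    using D K by (simp add: field_simps)
  with wP show False
    by simp
qed

theorem theorem2:
  shows "\<exists>c>0. \<forall>\<epsilon>>0. \<exists>n0. \<forall>n\<ge>n0. \<forall>vmin>0. \<forall>M.
           clock_auction n vmin M \<and> consistency n vmin M \<le> ereal (1 + \<epsilon>) \<longrightarrow>
           robustness n vmin M \<ge> ereal (c / \<epsilon> * ln (real n))"
proof (intro exI[of _ "1 / 2"] conjI allI impI)
  fix \<epsilon> :: real
  assume eps: "0 < \<epsilon>"
  show "\<exists>n0. \<forall>n\<ge>n0. \<forall>vmin>0. \<forall>M.
           clock_auction n vmin M \<and> consistency n vmin M \<le> ereal (1 + \<epsilon>) \<longrightarrow>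
           robustness n vmin M \<ge> ereal (1 / 2 / \<epsilon> * ln (real n))"
  \<comment> \<open>The threshold makes \<open>ln n\<close> at least \<open>2 * \<epsilon>\<close>,
    so that \<open>D \<le> K\<close>, and more than 2, so that
    \<open>ln n / 2 < ln n - 1\<close>.\<close>
  proof (intro exI[of _ "nat \<lceil>exp (2 * \<epsilon> + 3)\<rceil>"] allI impI)
    fix n :: nat and vmin :: real and M :: auction
    assume n: "nat \<lceil>exp (2 * \<epsilon> + 3)\<rceil> \<le> n" and vmin: "0 < vmin"
      and M: "clock_auction n vmin M \<and> consistency n vmin M \<le> ereal (1 + \<epsilon>)"
    have exp: "exp (2 * \<epsilon> + 3) \<le> real n"
      using n by linarith
    moreover have "1 < exp (2 * \<epsilon> + 3)"
      using eps by simp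
    ultimately have n2: "2 \<le> n"
      by linarith
    then have ln: "2 * \<epsilon> + 3 \<le> ln (real n)"
      using exp by (simp add: ln_ge_iff)
    \<comment> \<open>\<open>K / D\<close> is exactly the claimed bound, and
      \<open>\<epsilon> * K\<close> is \<open>D * ln n / 2\<close>, below the harmonic loss.\<close>
    define D K where "D = real (n - 1) * vmin" and "K = D * (ln (real n) / (2 * \<epsilon>))"
    have D: "0 < D"
      using n2 vmin by (simp add: D_def)
    have "D * 1 \<le> K"
      unfolding K_def using D ln eps by (intro mult_left_mono) (auto simp: field_simps)
    moreover have "\<epsilon> * K < D * (harm (n - 1) - 1)"
    proof -
      have "ln (real n) \<le> harm (n - 1)"
        using ln_le_harm[of "n - 1"] n2 by (simp add: of_nat_diff)
      then have "D * (ln (real n) / 2) < D * (harm (n - 1) - 1)"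
        using D ln eps by (intro mult_strict_left_mono) auto
      then show ?thesis
        using eps by (simp add: K_def)
    qed
    ultimately have "ereal (K / D) \<le> robustness n vmin M"
      using vmin eps n2 M unfolding D_def by (intro robustness_lower_bound) auto
    then show "ereal (1 / 2 / \<epsilon> * ln (real n)) \<le> robustness n vmin M"
      using D by (simp add: K_def)
  qed
qed simp

end
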